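(* Let $q>\varphi=\frac{1+\sqrt5}{2}$. (i) Suppose $q\le 1+\sqrt3$, let $x\in[0,S(q,0)]$, and define the sequences $(r_h)_{h\ge0}$ and $(u_h)_{h\ge0}$ by $$r_0=x,\qquad u_h=\begin{cases}1&\text{if } r_h\in[f_h,S(q,h)],\\ 0&\text{otherwise,}\end{cases}\qquad r_{h+1}=q\,(r_h-u_hf_h).$$ Then $$x=\sum_{k=0}^\infty\frac{f_k}{q^k}u_k ,$$ and, consequently, $R_\infty(q)=[0,S(q,0)]$. (ii) If $q>1+\sqrt3$, then $R_\infty(q)\subsetneq[0,S(q,0)]$.
   Context: $(f_n)_{n\ge 0}$ is the Fibonacci sequence with $f_0=f_1=1$ and $f_{n+2}=f_{n+1}+f_n$. For $q>\varphi$ and an integer $h\ge0$, $$S(q,h)=\sum_{k=0}^\infty\frac{f_{h+k}}{q^k},\qquad R_\infty(q)=\left\{\sum_{k=0}^\infty u_k\frac{f_k}{q^k}\;\middle|\;u_k\in\{0,1\}\text{ for all }k\ge 0\right\}.$$ *)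

theory Defs
  imports "HOL-Analysis.Analysis" "HOL-Number_Theory.Fib"
begin

text \<open>The library sequence \<^const>\<open>fib\<close> starts with \<open>0, 1\<close>; here the sequence starts with
  \<open>1, 1\<close>, whence the shift by one.\<close>

definition fibo :: "nat \<Rightarrow> nat"
  where "fibo n = fib (Suc n)"

lemma fibo_0: "fibo 0 = 1"
  and fibo_1: "fibo 1 = 1"
  and fibo_rec: "fibo (n + 2) = fibo (n + 1) + fibo n"
  by (simp_all add: fibo_def)

definition fib_tail :: "real \<Rightarrow> nat \<Rightarrow> real"
  where "fib_tail q h = (\<Sum>k. real (fibo (h + k)) / q ^ k)"

text \<open>For \<open>q\<close> above the golden ratio all series below converge absolutely, so the
  default value of \<^const>\<open>suminf\<close> for divergent series plays no role.\<close>

definition fib_reach :: "real \<Rightarrow> real set"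
  where "fib_reach q =
    {(\<Sum>k. u k * (real (fibo k) / q ^ k)) | u :: nat \<Rightarrow> real. \<forall>k. u k \<in> {0, 1}}"

text \<open>The digit at position \<open>h\<close> is a function of the current remainder; this makes the mutual
  recursion between digits and remainders primitive recursive.\<close>

definition digit_of :: "real \<Rightarrow> nat \<Rightarrow> real \<Rightarrow> real"
  where "digit_of q h r = (if r \<in> {real (fibo h)..fib_tail q h} then 1 else 0)"

primrec greedy_rem :: "real \<Rightarrow> real \<Rightarrow> nat \<Rightarrow> real"
  where
    "greedy_rem q x 0 = x"
  | "greedy_rem q x (Suc h) =
      q * (greedy_rem q x h - digit_of q h (greedy_rem q x h) * real (fibo h))"

definition greedy_digit :: "real \<Rightarrow> real \<Rightarrow> nat \<Rightarrow> real"
  where "greedy_digit q x h = digit_of q h (greedy_rem q x h)"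

end

theory Submission
  imports Defs
begin

text \<open>
  Write \<open>\<phi>\<close> for the golden ratio, \<open>f\<close> for \<^const>\<open>fibo\<close> and \<open>S h\<close> for \<^term>\<open>fib_tail q h\<close>.
  After the digits \<open>u\<^sub>0, \<dots>, u\<^sub>h\<^sub>-\<^sub>1\<close> of \<open>x\<close> have been chosen, the remainder \<open>r\<close> at position
  \<open>h\<close>, rescaled by \<open>q ^ h\<close>, has to be a sum \<open>\<Sum>k. u (h + k) * f (h + k) / q ^ k\<close>, hence it must
  lie in \<open>{0..S h}\<close>. If it does and if \<open>r \<ge> f h\<close>, then choosing the digit \<open>1\<close> leaves a remainder
  in \<open>{0..S (h + 1)}\<close>, because \<open>S h = f h + S (h + 1) / q\<close>. If \<open>r < f h\<close>, the digit must be \<open>0\<close>, and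
  the next remainder \<open>q * r\<close>, which can be anything below \<open>q * f h\<close>, stays in the
  admissible interval as soon as \<open>q * f h \<le> S (h + 1)\<close>. So the greedy
  algorithm works when this no-gap inequality holds at every position, and then the error after
  \<open>h\<close> digits is at most \<open>S h / q ^ h\<close>, a tail of a convergent series.

  Both sides of the no-gap inequality satisfy the Fibonacci recursion in \<open>h\<close>, so it
  holds everywhere once it holds at \<open>h = 0\<close> (lemma \<open>no_gap_propagates\<close>). The two linear
  relations for \<open>S\<close> determine \<open>S 1 = (q\<^sup>2 + q) / (q\<^sup>2 - q - 1)\<close>, and \<open>q \<le> S 1\<close> becomes
  \<open>q\<^sup>2 - 2 * q - 2 \<le> 0\<close>, that is, \<open>q \<le> 1 + sqrt 3\<close> (lemma \<open>no_gap_iff\<close>). For larger \<open>q\<close>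
  there is a genuine gap at the first digit: sums with \<open>u\<^sub>0 = 0\<close> are at most \<open>S 1 / q < 1\<close>,
  whereas sums with \<open>u\<^sub>0 = 1\<close> are at least \<open>1\<close>.
\<close>

lemma fibo_le_golden_power: "real (fibo n) \<le> ((1 + sqrt 5) / 2) ^ n"
proof (induction n rule: fib.induct)
  case (3 n)
  define g :: real where "g = (1 + sqrt 5) / 2"
  have "g * g = g + 1"
    unfolding g_def by (simp add: field_simps)
  then have "g ^ Suc (Suc n) = g ^ Suc n + g ^ n"
    by (simp add: distrib_right flip: mult.assoc)
  with 3 show ?case
    using fibo_rec[of n] unfolding g_def[symmetric] by simp
qed (simp_all add: fibo_def)

context
  fixes q :: real
  assumes q: "q > (1 + sqrt 5) / 2"
begin

lemma base_gt_1: "q > 1"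
proof -
  have "(1 + sqrt 5) / 2 > 1" by simp
  with q show ?thesis by (rule less_trans[rotated])
qed

lemma quadratic_pos: "q\<^sup>2 - q - 1 > 0"
proof -
  have "(2 * q - 1)\<^sup>2 > (sqrt 5)\<^sup>2"
    using q by (intro power_strict_mono) auto
  then show ?thesis
    by (simp add: power2_eq_square algebra_simps)
qed

lemma summable_fibo_series: "summable (\<lambda>k. real (fibo k) / q ^ k)"
proof (rule summable_comparison_test')
  show "summable (\<lambda>k. ((1 + sqrt 5) / 2 / q) ^ k)"
    using q base_gt_1 by (intro summable_geometric) simp
  show "norm (real (fibo k) / q ^ k) \<le> ((1 + sqrt 5) / 2 / q) ^ k" for k
    using divide_right_mono[OF fibo_le_golden_power[of k], of "q ^ k"] base_gt_1
    by (simp add: power_divide)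
qed

lemma summable_fib_tail: "summable (\<lambda>k. real (fibo (h + k)) / q ^ k)"
proof -
  have "summable (\<lambda>k. q ^ h * (real (fibo (k + h)) / q ^ (k + h)))"
    using summable_fibo_series
    by (intro summable_mult summable_ignore_initial_segment)
  then show ?thesis
    using base_gt_1 by (simp add: power_add add.commute)
qed

lemma fib_tail_nonneg: "fib_tail q h \<ge> 0"
  unfolding fib_tail_def
  using base_gt_1 by (intro suminf_nonneg summable_fib_tail) simp

lemma fib_tail_split: "fib_tail q h = real (fibo h) + fib_tail q (Suc h) / q"
proof -
  have "fib_tail q (Suc h) / q = (\<Sum>k. real (fibo (Suc h + k)) / q ^ k / q)"
    unfolding fib_tail_def by (intro suminf_divide[symmetric] summable_fib_tail)
  then show ?thesis
    using suminf_split_head[OF summable_fib_tail[of h]]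
    unfolding fib_tail_def by (simp add: mult.commute)
qed

lemma fib_tail_recursion: "fib_tail q (h + 2) = fib_tail q (h + 1) + fib_tail q h"
proof -
  have "real (fibo (h + 2 + k)) / q ^ k
      = real (fibo (h + 1 + k)) / q ^ k + real (fibo (h + k)) / q ^ k" for k
    using fibo_rec[of "h + k"] by (simp add: add_divide_distrib add_ac)
  then show ?thesis
    unfolding fib_tail_def
    by (simp only: suminf_add[OF summable_fib_tail summable_fib_tail])
qed

lemma fib_tail_eq_remainder:
  "fib_tail q h / q ^ h = fib_tail q 0 - (\<Sum>k<h. real (fibo k) / q ^ k)"
proof (induction h)
  case (Suc h)
  have "fib_tail q h / q ^ h = real (fibo h) / q ^ h + fib_tail q (Suc h) / q ^ Suc h"
    using fib_tail_split[of h] by (simp add: add_divide_distrib)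
  with Suc show ?case by simp
qed simp

lemma fib_tail_tendsto_0: "(\<lambda>h. fib_tail q h / q ^ h) \<longlonglongrightarrow> 0"
proof -
  have "(\<lambda>h. \<Sum>k<h. real (fibo k) / q ^ k) \<longlonglongrightarrow> fib_tail q 0"
    using summable_LIMSEQ[OF summable_fibo_series] by (simp add: fib_tail_def)
  from tendsto_diff[OF tendsto_const[of "fib_tail q 0"] this] show ?thesis
    by (simp add: fib_tail_eq_remainder)
qed

text \<open>Eliminating \<open>S 0\<close> and \<open>S 2\<close> from \<open>S 0 = 1 + S 1 / q\<close>, \<open>S 1 = 1 + S 2 / q\<close> and
  \<open>S 2 = S 1 + S 0\<close>.\<close>

lemma fib_tail_1: "fib_tail q 1 = (q\<^sup>2 + q) / (q\<^sup>2 - q - 1)"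
proof -
  have "q * fib_tail q 0 = q + fib_tail q 1"
    using fib_tail_split[of 0] base_gt_1 by (simp add: fibo_0 field_simps)
  moreover have "q * fib_tail q 1 = q + fib_tail q 1 + fib_tail q 0"
    using fib_tail_split[of 1] fib_tail_recursion[of 0] base_gt_1 fibo_1
    by (simp add: field_simps numeral_2_eq_2)
  ultimately have "fib_tail q 1 * (q\<^sup>2 - q - 1) = q\<^sup>2 + q"
    by algebra
  then show ?thesis
    using quadratic_pos by (simp add: field_simps)
qed

lemma no_gap_iff: "q \<le> fib_tail q 1 \<longleftrightarrow> q \<le> 1 + sqrt 3"
proof -
  have "q \<le> fib_tail q 1 \<longleftrightarrow> q * (q\<^sup>2 - q - 1) \<le> q * (q + 1)"
    unfolding fib_tail_1 pos_le_divide_eq[OF quadratic_pos]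
    by (simp add: power2_eq_square distrib_left)
  also have "\<dots> \<longleftrightarrow> q\<^sup>2 - q - 1 \<le> q + 1"
    using base_gt_1 by simp
  also have "\<dots> \<longleftrightarrow> (q - 1)\<^sup>2 \<le> 3"
    by (auto simp: power2_eq_square algebra_simps)
  also have "\<dots> \<longleftrightarrow> q - 1 \<le> sqrt 3"
    using base_gt_1 real_le_rsqrt real_sqrt_ge_zero
    by (metis abs_of_pos diff_gt_0_iff_gt real_sqrt_abs real_sqrt_le_iff)
  finally show ?thesis by linarith
qed

text \<open>Both sides satisfy the Fibonacci recursion, so only the first two positions matter, and
  the second follows from the first because \<open>f 1 = f 0\<close> while \<open>S 2 = S 1 + S 0 \<ge> S 1\<close>.\<close>

lemma no_gap_propagates:
  assumes "q \<le> fib_tail q 1"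
  shows "q * real (fibo h) \<le> fib_tail q (Suc h)"
proof (induction h rule: fib.induct)
  case 1
  show ?case using assms by (simp add: fibo_0)
next
  case 2
  show ?case
    using assms fib_tail_recursion[of 0] fib_tail_nonneg[of 0] fibo_1
    by (simp add: numeral_2_eq_2)
next
  case (3 h)
  then show ?case
    using fib_tail_recursion[of "Suc h"] fibo_rec[of h] by (simp add: distrib_left)
qed

text \<open>The invariant of the greedy algorithm. Digit \<open>1\<close> preserves it for every base, by
  \<open>fib_tail_split\<close>; digit \<open>0\<close> preserves it because there is no gap.\<close>

lemma greedy_rem_bounds:
  assumes "q \<le> fib_tail q 1" and "x \<in> {0..fib_tail q 0}"
  shows "greedy_rem q x h \<in> {0..fib_tail q h}"
proof (induction h)
  case 0
  show ?case using assms by simp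
next
  case (Suc h)
  let ?r = "greedy_rem q x h"
  show ?case
  proof (cases "?r \<ge> real (fibo h)")
    case True
    have "q * (?r - real (fibo h)) \<le> q * (fib_tail q h - real (fibo h))"
      using Suc base_gt_1 by simp
    also have "\<dots> = fib_tail q (Suc h)"
      using fib_tail_split[of h] base_gt_1 by simp
    finally show ?thesis
      using True Suc base_gt_1 by (simp add: digit_of_def)
  next
    case False
    then have "q * ?r \<le> q * real (fibo h)"
      using base_gt_1 by simp
    also have "\<dots> \<le> fib_tail q (Suc h)"
      by (rule no_gap_propagates[OF assms(1)])
    finally show ?thesis
      using False Suc base_gt_1 by (simp add: digit_of_def)
  qed
qed

lemma greedy_partial_sum:
  "(\<Sum>k<h. real (fibo k) / q ^ k * greedy_digit q x k) = x - greedy_rem q x h / q ^ h"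
proof (induction h)
  case (Suc h)
  then show ?case
    using base_gt_1 by (simp add: greedy_digit_def diff_divide_distrib)
qed simp

lemma greedy_sums:
  assumes "q \<le> fib_tail q 1" and "x \<in> {0..fib_tail q 0}"
  shows "(\<lambda>k. real (fibo k) / q ^ k * greedy_digit q x k) sums x"
proof -
  have "(\<lambda>h. greedy_rem q x h / q ^ h) \<longlonglongrightarrow> 0"
  proof (rule tendsto_sandwich[OF _ _ tendsto_const fib_tail_tendsto_0])
    show "\<forall>\<^sub>F h in sequentially. 0 \<le> greedy_rem q x h / q ^ h"
      using greedy_rem_bounds[OF assms] base_gt_1 by (intro always_eventually) simp
    show "\<forall>\<^sub>F h in sequentially. greedy_rem q x h / q ^ h \<le> fib_tail q h / q ^ h"
      using greedy_rem_bounds[OF assms] base_gt_1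
      by (intro always_eventually) (simp add: divide_right_mono)
  qed
  from tendsto_diff[OF tendsto_const[of x] this] show ?thesis
    unfolding sums_def greedy_partial_sum by simp
qed

text \<open>Isolating the digit \<open>u 0\<close>, whose weight is \<open>f 0 = 1\<close>: the other digits contribute between
  \<open>0\<close> and \<open>S 0 - 1\<close>. This gives the inclusion of the reachable set in \<open>{0..S 0}\<close>,
  and it exposes the gap between \<open>S 0 - 1\<close> and \<open>1\<close> when \<open>S 0 < 2\<close>.\<close>

lemma digit_series:
  fixes u :: "nat \<Rightarrow> real"
  assumes "\<forall>k. u k \<in> {0, 1}"
  shows summable_digit_series: "summable (\<lambda>k. u k * (real (fibo k) / q ^ k))"
    and digit_series_le: "(\<Sum>k. u k * (real (fibo k) / q ^ k)) \<le> u 0 + (fib_tail q 0 - 1)"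
    and digit_series_ge: "u 0 \<le> (\<Sum>k. u k * (real (fibo k) / q ^ k))"
proof -
  let ?a = "\<lambda>k. real (fibo k) / q ^ k" and ?t = "\<lambda>k. u k * (real (fibo k) / q ^ k)"
  have a: "?a k \<ge> 0" for k
    using base_gt_1 by simp
  have t: "0 \<le> ?t k" "?t k \<le> ?a k" for k
    using assms[rule_format, of k] a[of k] by auto
  show sm: "summable ?t"
  proof (rule summable_comparison_test'[OF summable_fibo_series])
    show "norm (?t k) \<le> ?a k" for k
      unfolding real_norm_def abs_of_nonneg[OF t(1)] by (rule t(2))
  qed
  have smS: "summable (\<lambda>k. ?t (Suc k))" and saS: "summable (\<lambda>k. ?a (Suc k))"
    by (fact summable_Suc_iff[THEN iffD2, OF sm]
        summable_Suc_iff[THEN iffD2, OF summable_fibo_series])+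
  have "suminf ?t = u 0 + (\<Sum>k. ?t (Suc k))"
    using suminf_split_head[OF sm] by (simp add: fibo_0)
  moreover have "(\<Sum>k. ?a (Suc k)) = fib_tail q 0 - 1"
    using suminf_split_head[OF summable_fibo_series] by (simp add: fibo_0 fib_tail_def)
  moreover have "(\<Sum>k. ?t (Suc k)) \<le> (\<Sum>k. ?a (Suc k))"
    by (rule suminf_le[OF t(2) smS saS])
  moreover have "0 \<le> (\<Sum>k. ?t (Suc k))"
    by (rule suminf_nonneg[OF smS t(1)])
  ultimately show "suminf ?t \<le> u 0 + (fib_tail q 0 - 1)" and "u 0 \<le> suminf ?t"
    by linarith+
qed

lemma fib_reach_subset: "fib_reach q \<subseteq> {0..fib_tail q 0}"
proof
  fix x assume "x \<in> fib_reach q"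
  then obtain u :: "nat \<Rightarrow> real" where u: "\<forall>k. u k \<in> {0, 1}"
    and x: "x = (\<Sum>k. u k * (real (fibo k) / q ^ k))"
    unfolding fib_reach_def by auto
  have "0 \<le> u 0" "u 0 \<le> 1"
    using u[rule_format, of 0] by auto
  then show "x \<in> {0..fib_tail q 0}"
    using digit_series_le[OF u] digit_series_ge[OF u] x by simp
qed

lemma fib_reach_eq:
  assumes "q \<le> fib_tail q 1"
  shows "fib_reach q = {0..fib_tail q 0}"
proof (intro equalityI fib_reach_subset subsetI)
  fix x assume "x \<in> {0..fib_tail q 0}"
  from greedy_sums[OF assms this]
  have "x = (\<Sum>k. greedy_digit q x k * (real (fibo k) / q ^ k))"
    by (simp add: sums_iff mult.commute)
  moreover have "\<forall>k. greedy_digit q x k \<in> {0, 1}"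
    by (simp add: greedy_digit_def digit_of_def)
  ultimately show "x \<in> fib_reach q"
    unfolding fib_reach_def by blast
qed

lemma fib_reach_psubset:
  assumes "fib_tail q 1 < q"
  shows "fib_reach q \<subset> {0..fib_tail q 0}"
proof -
  have S0: "fib_tail q 0 - 1 = fib_tail q 1 / q"
    using fib_tail_split[of 0] by (simp add: fibo_0)
  have gap: "fib_tail q 0 - 1 < 1" and ge: "0 \<le> fib_tail q 0 - 1"
    unfolding S0 using assms base_gt_1 fib_tail_nonneg[of 1] by simp_all
  \<comment> \<open>Half of \<open>S 0\<close> is the midpoint of the gap between \<open>S 0 - 1\<close> and \<open>1\<close>.\<close>
  have "fib_tail q 0 / 2 \<notin> fib_reach q"
  proof
    assume "fib_tail q 0 / 2 \<in> fib_reach q"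
    then obtain u :: "nat \<Rightarrow> real" where u: "\<forall>k. u k \<in> {0, 1}"
      and x: "fib_tail q 0 / 2 = (\<Sum>k. u k * (real (fibo k) / q ^ k))"
      unfolding fib_reach_def by blast
    have "u 0 = 0 \<or> u 0 = 1"
      using u by auto
    then show False
      using digit_series_le[OF u] digit_series_ge[OF u] gap unfolding x[symmetric] by auto
  qed
  moreover have "fib_tail q 0 / 2 \<in> {0..fib_tail q 0}"
    using fib_tail_nonneg[of 0] by simp
  ultimately show ?thesis
    using fib_reach_subset by blast
qed

end

theorem theorem12:
  fixes q :: real
  assumes "q > (1 + sqrt 5) / 2"
  shows "(q \<le> 1 + sqrt 3 \<longrightarrow>
            (\<forall>x \<in> {0..fib_tail q 0}.
               (\<lambda>k. real (fibo k) / q ^ k * greedy_digit q x k) sums x) \<and>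
            fib_reach q = {0..fib_tail q 0}) \<and>
         (q > 1 + sqrt 3 \<longrightarrow> fib_reach q \<subset> {0..fib_tail q 0})"
  using greedy_sums[OF assms] fib_reach_eq[OF assms] fib_reach_psubset[OF assms]
  unfolding no_gap_iff[OF assms] not_le[symmetric] by blast

end
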